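(* Let $f\in B\mathcal S_{\mathbf M}$ have a Fourier series of the form $(F)$ (see context). Let $\tau>0$ and let $\varphi\in\Phi$ be nondecreasing on the interval $[0,\tau]$ with $\varphi(\tau)=\max\{\varphi(t):t\in\mathbb R\}$. Then for every $n\in\mathbb N$, $$\omega_\varphi\Big(f,\frac{\tau}{\lambda_n}\Big)_{\mathbf M}\le\sum_{\nu=1}^n\Big(\varphi\Big(\frac{\tau\lambda_\nu}{\lambda_n}\Big)-\varphi\Big(\frac{\tau\lambda_{\nu-1}}{\lambda_n}\Big)\Big)E_{\lambda_\nu}(f)_{\mathbf M}.$$
   Context: Almost periodic functions. A locally Lebesgue integrable $f:\mathbb R\to\mathbb C$ is called $B$-a.p. (Besicovitch almost periodic of order 1) if there are trigonometric sums $\tau_N(x)=\sum_{k} a_k e^{i\mu_k x}$ (finite sums, $\mu_k\in\mathbb R$, $a_k\in\mathbb C$) with $\limsup_{T\to\infty}\frac1{2T}\int_{-T}^T|f-\tau_N|\,dx\to0$ as $N\to\infty$. For such $f$ the mean value $A\{f\}=\lim_{T\to\infty}\frac1T\int_0^Tf(x)\,dx$ exists, and the Fourier exponents of $f$ are the (at most countably many) $\lambda\in\mathbb R$ with $A\{f(\cdot)e^{-i\lambda\cdot}\}\ne0$. Exponents. $\{\lambda_k\}_{k\in\mathbb Z}$ is a real sequence with $\lambda_0=0$, $\lambda_{-k}=-\lambda_k$, $0<\lambda_k<\lambda_{k+1}$ for $k\ge1$, and $\lambda_k\to\infty$ as $k\to\infty$. All functions considered are $B$-a.p. with all Fourier exponents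 in $\{\lambda_k\}_{k\in\mathbb Z}$; put $A_k(f)=A\{f(\cdot)e^{-i\lambda_k\cdot}\}$. We say $f$ has a Fourier series of the form $(F)$ if its Fourier series is $\sum_{k\in\mathbb Z}A_k(f)e^{i\lambda_kx}$ with $|A_k(f)|+|A_{-k}(f)|>0$ for all $k\ge 1$. The space. $\mathbf M=\{M_k\}_{k\in\mathbb Z}$ is a sequence of Orlicz functions: each $M_k:[0,\infty)\to[0,\infty)$ is nondecreasing and convex, $M_k(0)=0$, $M_k(t)\to\infty$ as $t\to\infty$. Let $M_k^*(v)=\sup\{uv-M_k(u):u\ge0\}$, and let $\Gamma$ be the set of sequences of positive numbers $\gamma=\{\gamma_k\}_{k\in\mathbb Z}$ with $\sum_{k\in\mathbb Z}M_k^*(\gamma_k)\le1$. The space $B\mathcal S_{\mathbf M}$ consists of those functions $f$ for which $\|f\|_{\mathbf M}:=\sup\{\sum_{k\in\mathbb Z}\gamma_k|A_k(f)|:\gamma\in\Gamma\}<\infty$; functions with the same Fourier series are identified. Best approximation. $E_{\lambda_n}(f)_{\mathbf M}=\inf\|f-g\|_{\mathbf M}$, the infimum over all $g$ whose Fourier exponents lie in the interval $(-\lambda_n,\lambda_n)$. Generalized modulus of smoothness. $\Phi$ is the set of continuous bounded nonnegative even functions $\varphi:\mathbb R\to\mathbb R$ with $\varphi(0)=0$ whose zero set has Lebesgue measure zero. For $\varphi\in\Phi$ and $\delta\ge0$, $$\omega_\varphi(f,\delta)_{\mathbf M}=\sup_{|h|\le\delta}\ \sup\Big\{\sum_{k\in\mathbb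 Z}\gamma_k\varphi(\lambda_kh)|A_k(f)|:\gamma\in\Gamma\Big\}.$$ *)

theory Defs
  imports "HOL-Analysis.Analysis"
begin

section \<open>Besicovitch almost periodic functions\<close>

definition trig_sum :: "(real \<Rightarrow> complex) \<Rightarrow> bool" where
  "trig_sum p \<longleftrightarrow> (\<exists>S (a :: real \<Rightarrow> complex). finite S \<and>
     p = (\<lambda>x. \<Sum>\<mu>\<in>S. a \<mu> * exp (\<i> * complex_of_real (\<mu> * x))))"

definition locally_lebesgue_integrable :: "(real \<Rightarrow> complex) \<Rightarrow> bool" where
  "locally_lebesgue_integrable f \<longleftrightarrow> (\<forall>a b. set_integrable lebesgue {a..b} f)"

definition besicovitch_dist :: "(real \<Rightarrow> complex) \<Rightarrow> (real \<Rightarrow> complex) \<Rightarrow> ereal" where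
  "besicovitch_dist f g = Limsup at_top
     (\<lambda>T::real. ereal (1 / (2 * T) * (LINT x:{-T..T}|lebesgue. norm (f x - g x))))"

definition B_ap :: "(real \<Rightarrow> complex) \<Rightarrow> bool" where
  "B_ap f \<longleftrightarrow> locally_lebesgue_integrable f \<and>
     (\<exists>p :: nat \<Rightarrow> real \<Rightarrow> complex. (\<forall>N. trig_sum (p N)) \<and>
        (\<lambda>N. besicovitch_dist f (p N)) \<longlonglongrightarrow> 0)"

text \<open>The limit exists for every \<open>f\<close> satisfying \<^const>\<open>B_ap\<close>; for other functions the
  value carries no meaning.\<close>

definition mean_value :: "(real \<Rightarrow> complex) \<Rightarrow> complex" where
  "mean_value f = Lim at_top
     (\<lambda>T::real. complex_of_real (1 / T) * (LINT x:{0..T}|lebesgue. f x))"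

definition bohr_coeff :: "(real \<Rightarrow> complex) \<Rightarrow> real \<Rightarrow> complex" where
  "bohr_coeff f \<mu> = mean_value (\<lambda>x. f x * exp (- \<i> * complex_of_real (\<mu> * x)))"

definition fourier_exponents :: "(real \<Rightarrow> complex) \<Rightarrow> real set" where
  "fourier_exponents f = {\<mu>. bohr_coeff f \<mu> \<noteq> 0}"


section \<open>Exponent sequences\<close>

definition exponent_seq :: "(int \<Rightarrow> real) \<Rightarrow> bool" where
  "exponent_seq lam \<longleftrightarrow> lam 0 = 0 \<and> (\<forall>k. lam (- k) = - lam k) \<and>
     (\<forall>k\<ge>1. 0 < lam k \<and> lam k < lam (k + 1)) \<and> filterlim lam at_top at_top"

definition B_ap_exps :: "(int \<Rightarrow> real) \<Rightarrow> (real \<Rightarrow> complex) set" where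
  "B_ap_exps lam = {f. B_ap f \<and> fourier_exponents f \<subseteq> range lam}"

definition fourier_series_F :: "(int \<Rightarrow> real) \<Rightarrow> (real \<Rightarrow> complex) \<Rightarrow> bool" where
  "fourier_series_F lam f \<longleftrightarrow> f \<in> B_ap_exps lam \<and>
     (\<forall>k\<ge>1. norm (bohr_coeff f (lam k)) + norm (bohr_coeff f (lam (- k))) > 0)"


section \<open>Besicovitch--Musielak--Orlicz spaces\<close>

text \<open>An Orlicz function is a function on \<open>[0, \<infinity>)\<close>; its values at negative
  arguments are unconstrained and never used.\<close>

definition orlicz_function :: "(real \<Rightarrow> real) \<Rightarrow> bool" where
  "orlicz_function M \<longleftrightarrow> (\<forall>t\<ge>0. 0 \<le> M t) \<and> mono_on {0..} M \<and> convex_on {0..} M \<and>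
     M 0 = 0 \<and> filterlim M at_top at_top"

text \<open>The conjugate may be infinite. Truncation of negative values by \<^const>\<open>ennreal\<close> is
  harmless, since \<open>u = 0\<close> contributes \<open>0\<close> when \<open>M 0 = 0\<close>.\<close>

definition orlicz_conj :: "(real \<Rightarrow> real) \<Rightarrow> real \<Rightarrow> ennreal" where
  "orlicz_conj M v = (SUP u\<in>{0..}. ennreal (u * v - M u))"

definition Gamma_set :: "(int \<Rightarrow> real \<Rightarrow> real) \<Rightarrow> (int \<Rightarrow> real) set" where
  "Gamma_set M = {\<gamma>. (\<forall>k. 0 < \<gamma> k) \<and> (\<Sum>\<^sub>\<infinity>k\<in>UNIV. orlicz_conj (M k) (\<gamma> k)) \<le> 1}"

definition M_norm ::
  "(int \<Rightarrow> real) \<Rightarrow> (int \<Rightarrow> real \<Rightarrow> real) \<Rightarrow> (real \<Rightarrow> complex) \<Rightarrow> ennreal" where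
  "M_norm lam M f = (SUP \<gamma>\<in>Gamma_set M.
     (\<Sum>\<^sub>\<infinity>k\<in>UNIV. ennreal (\<gamma> k * norm (bohr_coeff f (lam k)))))"

text \<open>Functions with equal Fourier series are not identified by passing to a quotient: the
  norm, the best approximation and the modulus depend on \<open>f\<close> only through its Fourier
  coefficients.\<close>

definition BS_space ::
  "(int \<Rightarrow> real) \<Rightarrow> (int \<Rightarrow> real \<Rightarrow> real) \<Rightarrow> (real \<Rightarrow> complex) set" where
  "BS_space lam M = {f \<in> B_ap_exps lam. M_norm lam M f < \<infinity>}"

definition best_approx ::
  "(int \<Rightarrow> real) \<Rightarrow> (int \<Rightarrow> real \<Rightarrow> real) \<Rightarrow> real \<Rightarrow> (real \<Rightarrow> complex) \<Rightarrow> ennreal" where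
  "best_approx lam M \<sigma> f =
     (INF g\<in>{g \<in> B_ap_exps lam. fourier_exponents g \<subseteq> {-\<sigma><..<\<sigma>}}. M_norm lam M (\<lambda>x. f x - g x))"


section \<open>Generalized modulus of smoothness\<close>

definition Phi_class :: "(real \<Rightarrow> real) set" where
  "Phi_class = {\<phi>. continuous_on UNIV \<phi> \<and> bounded (range \<phi>) \<and> (\<forall>t. 0 \<le> \<phi> t) \<and>
     (\<forall>t. \<phi> (- t) = \<phi> t) \<and> \<phi> 0 = 0 \<and> {t. \<phi> t = 0} \<in> null_sets lebesgue}"

definition gen_modulus ::
  "(int \<Rightarrow> real) \<Rightarrow> (int \<Rightarrow> real \<Rightarrow> real) \<Rightarrow> (real \<Rightarrow> real) \<Rightarrow> (real \<Rightarrow> complex) \<Rightarrow> real \<Rightarrow> ennreal" where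
  "gen_modulus lam M \<phi> f \<delta> = (SUP h\<in>{h. \<bar>h\<bar> \<le> \<delta>}. SUP \<gamma>\<in>Gamma_set M.
     (\<Sum>\<^sub>\<infinity>k\<in>UNIV. ennreal (\<gamma> k * \<phi> (lam k * h) * norm (bohr_coeff f (lam k)))))"

end

theory Submission
  imports Defs
begin

text \<open>
  Let \<open>\<Delta>\<^sub>\<nu> = \<phi> (\<tau> \<lambda>\<^sub>\<nu> / \<lambda>\<^sub>n) - \<phi> (\<tau> \<lambda>\<^sub>\<nu>\<^sub>-\<^sub>1 / \<lambda>\<^sub>n)\<close>, which is nonnegative for \<open>1 \<le> \<nu> \<le> n\<close>.
  For \<open>\<bar>h\<bar> \<le> \<tau> / \<lambda>\<^sub>n\<close> the multiplier \<open>\<phi> (\<lambda>\<^sub>k h)\<close> is at most \<open>\<phi> (\<tau> \<lambda>\<^sub>m / \<lambda>\<^sub>n)\<close> with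
  \<open>m = min \<bar>k\<bar> n\<close>: monotonicity on \<open>[0, \<tau>]\<close> gives this for \<open>\<bar>k\<bar> \<le> n\<close>, and maximality of \<open>\<phi> \<tau>\<close>
  gives it for \<open>\<bar>k\<bar> > n\<close>. As \<open>\<phi> 0 = 0\<close>, this bound telescopes into the sum of \<open>\<Delta>\<^sub>\<nu>\<close> over
  \<open>1 \<le> \<nu> \<le> n\<close> with \<open>\<nu> \<le> \<bar>k\<bar>\<close>. Interchanging the two summations (Abel summation) leaves, for
  each weight \<open>\<gamma>\<close>, the sum over \<open>\<nu>\<close> of \<open>\<Delta>\<^sub>\<nu>\<close> times the tail \<open>\<Sum>\<^bsub>\<bar>k\<bar> \<ge> \<nu>\<^esub> \<gamma>\<^sub>k \<bar>A\<^sub>k(f)\<bar>\<close>.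

  Such a tail is at most the best approximation \<open>E(f)\<close> of order \<open>\<lambda>\<^sub>\<nu>\<close>: a competitor \<open>g\<close> with
  exponents in \<open>(-\<lambda>\<^sub>\<nu>, \<lambda>\<^sub>\<nu>)\<close> has \<open>A\<^sub>k(g) = 0\<close> for \<open>\<bar>k\<bar> \<ge> \<nu>\<close>, so \<open>f\<close> and \<open>f - g\<close> have the same tail
  (lemma \<open>tail_sum_le_best_approx\<close>). The step \<open>A\<^sub>k(f - g) = A\<^sub>k(f) - A\<^sub>k(g)\<close> is where almost
  periodicity enters: it requires the mean values to be genuine limits. They are, because the
  averages of a trigonometric sum converge and the averages of an almost periodic function stay
  within an arbitrarily small distance of those of such a sum, hence form a Cauchy filter
  (lemma \<open>B_ap_average_convergent\<close>).
\<close>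

section \<open>Existence of Bohr coefficients\<close>

definition average :: "(real \<Rightarrow> complex) \<Rightarrow> real \<Rightarrow> complex" where
  "average f T = complex_of_real (1 / T) * (LINT x:{0..T}|lebesgue. f x)"

definition twist :: "real \<Rightarrow> (real \<Rightarrow> complex) \<Rightarrow> real \<Rightarrow> complex" where
  "twist \<mu> f = (\<lambda>x. f x * exp (- \<i> * complex_of_real (\<mu> * x)))"

lemma twist_diff: "twist \<mu> (\<lambda>x. f x - g x) = (\<lambda>x. twist \<mu> f x - twist \<mu> g x)"
  by (simp add: twist_def left_diff_distrib)

lemma norm_exp_character: "norm (exp (- \<i> * complex_of_real t)) = 1"
  using norm_exp_i_times[of "- t"] by simp

lemma norm_twist: "norm (twist \<mu> f x) = norm (f x)"
  by (simp only: twist_def norm_mult norm_exp_character mult_1_right)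

lemma locally_lebesgue_integrableD:
  "locally_lebesgue_integrable f \<Longrightarrow> set_integrable lebesgue {a..b} f"
  by (simp add: locally_lebesgue_integrable_def)

lemma locally_lebesgue_integrable_continuous:
  assumes "continuous_on UNIV f"
  shows "locally_lebesgue_integrable f"
  unfolding locally_lebesgue_integrable_def
  using absolutely_integrable_continuous[of _ _ f] assms
  by (metis box_real(2) continuous_on_subset top_greatest)

lemma locally_lebesgue_integrable_exp:
  "locally_lebesgue_integrable (\<lambda>x. c * exp (\<i> * complex_of_real (\<nu> * x)))"
  by (intro locally_lebesgue_integrable_continuous continuous_intros)

lemma locally_lebesgue_integrable_diff:
  assumes "locally_lebesgue_integrable f" "locally_lebesgue_integrable g"
  shows "locally_lebesgue_integrable (\<lambda>x. f x - g x)"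
  using assms unfolding locally_lebesgue_integrable_def by (auto intro: set_integral_diff(1))

lemma locally_lebesgue_integrable_twist:
  assumes "locally_lebesgue_integrable f"
  shows "locally_lebesgue_integrable (twist \<mu> f)"
  unfolding locally_lebesgue_integrable_def
proof (intro allI)
  fix a b :: real
  let ?e = "\<lambda>x::real. exp (- \<i> * complex_of_real (\<mu> * x))"
  have "continuous_on {a..b} ?e" by (intro continuous_intros)
  then have "?e \<in> borel_measurable (lebesgue_on {a..b})"
    by (intro continuous_imp_measurable_on_sets_lebesgue) auto
  moreover have "bounded (?e ` {a..b})"
  proof (rule boundedI)
    fix y assume "y \<in> ?e ` {a..b}"
    then show "norm y \<le> 1" using norm_exp_character by (elim imageE) (simp only: order_refl)
  qed
  ultimately have "(\<lambda>x. ?e x * f x) absolutely_integrable_on {a..b}"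
    by (intro absolutely_integrable_bounded_measurable_product[where h = "(*)", OF bilinear_times]
        locally_lebesgue_integrableD[OF assms]) simp_all
  then show "set_integrable lebesgue {a..b} (twist \<mu> f)"
    unfolding twist_def by (simp only: mult.commute)
qed

lemma average_diff:
  assumes "locally_lebesgue_integrable f" "locally_lebesgue_integrable g"
  shows "average (\<lambda>x. f x - g x) T = average f T - average g T"
  using assms unfolding average_def locally_lebesgue_integrable_def
  by (simp add: set_integral_diff(2) right_diff_distrib)

lemma average_sum:
  assumes "finite S" "\<And>\<mu>. \<mu> \<in> S \<Longrightarrow> locally_lebesgue_integrable (f \<mu>)"
  shows "average (\<lambda>x. \<Sum>\<mu>\<in>S. f \<mu> x) T = (\<Sum>\<mu>\<in>S. average (f \<mu>) T)"
proof -
  have "(LINT x:{0..T}|lebesgue. \<Sum>\<mu>\<in>S. f \<mu> x) = (\<Sum>\<mu>\<in>S. LINT x:{0..T}|lebesgue. f \<mu> x)"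
    using assms unfolding locally_lebesgue_integrable_def set_lebesgue_integral_def set_integrable_def
    unfolding scaleR_sum_right by (intro Bochner_Integration.integral_sum) simp
  then show ?thesis by (simp add: average_def sum_distrib_left)
qed

text \<open>For \<open>\<nu> \<noteq> 0\<close> the integral of \<open>exp (i\<nu>x)\<close> over \<open>[0, T]\<close> is bounded in \<open>T\<close>, so dividing by
  \<open>T\<close> sends it to \<open>0\<close>; for \<open>\<nu> = 0\<close> the average is constant in \<open>T > 0\<close>.\<close>

lemma average_exp_convergent:
  "\<exists>L. (average (\<lambda>x. c * exp (\<i> * complex_of_real (\<nu> * x))) \<longlongrightarrow> L) at_top"
proof -
  let ?e = "\<lambda>x::real. c * exp (\<i> * complex_of_real (\<nu> * x))"
  have lint: "(LINT x:{0..T}|lebesgue. ?e x) = integral {0..T} ?e" for T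
  proof -
    have "set_integrable lebesgue {0..T} ?e"
      by (intro locally_lebesgue_integrableD locally_lebesgue_integrable_exp)
    then show ?thesis by (rule set_lebesgue_integral_eq_integral(2))
  qed
  show ?thesis
  proof (cases "\<nu> = 0")
    case True
    have "\<forall>\<^sub>F T in at_top. average ?e T = c"
      using eventually_gt_at_top[of 0]
    proof eventually_elim
      case (elim T)
      then show ?case using True
        by (simp add: average_def lint[simplified True, simplified] scaleR_conv_of_real)
    qed
    then show ?thesis using tendsto_eventually by blast
  next
    case False
    let ?F = "\<lambda>x::real. c * exp (\<i> * complex_of_real (\<nu> * x)) / (\<i> * complex_of_real \<nu>)"
    have avg: "average ?e T = complex_of_real (1 / T) * (?F T - ?F 0)" if "T > 0" for T
    proof -
      have "(?e has_integral (?F T - ?F 0)) {0..T}"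
      proof (rule fundamental_theorem_of_calculus)
        show "(?F has_vector_derivative ?e x) (at x within {0..T})" for x
        proof -
          let ?G = "\<lambda>z. c * exp (\<i> * (complex_of_real \<nu> * z)) / (\<i> * complex_of_real \<nu>)"
          have "(?G has_field_derivative c * exp (\<i> * (complex_of_real \<nu> * of_real x))) (at (of_real x))"
            using False by (auto intro!: derivative_eq_intros simp: field_simps)
          from has_vector_derivative_real_field[OF this] show ?thesis by simp
        qed
      qed (use that in auto)
      then show ?thesis by (simp only: average_def lint integral_unique)
    qed
    have "((\<lambda>T::real. complex_of_real (1 / T) * (?F T - ?F 0)) \<longlongrightarrow> 0) at_top"
    proof (rule Lim_null_comparison)
      let ?C = "2 * norm c / \<bar>\<nu>\<bar>"
      show "\<forall>\<^sub>F T in at_top. norm (complex_of_real (1 / T) * (?F T - ?F 0)) \<le> ?C * (1 / T)"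
        using eventually_gt_at_top[of 0]
      proof eventually_elim
        case (elim T)
        have F: "norm (?F x) = norm c / \<bar>\<nu>\<bar>" for x
          using norm_exp_i_times[of "\<nu> * x"] by (simp add: norm_mult norm_divide)
        have "norm (?F T - ?F 0) \<le> ?C"
          using norm_triangle_ineq4[of "?F T" "?F 0"] unfolding F by simp
        from divide_right_mono[OF this, of T] show ?case
          using elim by (simp only: norm_mult norm_of_real) simp
      qed
      show "((\<lambda>T. ?C * (1 / T)) \<longlongrightarrow> 0) at_top"
        by (intro tendsto_mult_right_zero tendsto_divide_0[OF tendsto_const]
            filterlim_at_top_imp_at_infinity filterlim_ident)
    qed
    then have "(average ?e \<longlongrightarrow> 0) at_top"
      by (rule Lim_transform_eventually)
        (use eventually_gt_at_top[of 0] in eventually_elim, metis avg)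
    then show ?thesis by blast
  qed
qed

lemma trig_sum_locally_lebesgue_integrable:
  assumes "trig_sum p"
  shows "locally_lebesgue_integrable p"
proof (rule locally_lebesgue_integrable_continuous)
  show "continuous_on UNIV p"
    using assms unfolding trig_sum_def by (elim exE conjE) (simp only:, intro continuous_intros)
qed

lemma trig_sum_average_convergent:
  assumes "trig_sum p"
  shows "\<exists>L. (average (twist \<mu> p) \<longlongrightarrow> L) at_top"
proof -
  obtain S a where S: "finite S"
    and p: "p = (\<lambda>x. \<Sum>\<nu>\<in>S. a \<nu> * exp (\<i> * complex_of_real (\<nu> * x)))"
    using assms unfolding trig_sum_def by auto
  let ?e = "\<lambda>\<nu> x. a \<nu> * exp (\<i> * complex_of_real ((\<nu> - \<mu>) * x))"
  have "twist \<mu> p = (\<lambda>x. \<Sum>\<nu>\<in>S. ?e \<nu> x)"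
  proof
    fix x
    have "exp (\<i> * complex_of_real (\<nu> * x)) * exp (- \<i> * complex_of_real (\<mu> * x))
        = exp (\<i> * complex_of_real ((\<nu> - \<mu>) * x))" for \<nu>
      unfolding exp_add[symmetric] by (simp add: algebra_simps)
    then show "twist \<mu> p x = (\<Sum>\<nu>\<in>S. ?e \<nu> x)"
      unfolding twist_def p sum_distrib_right by (simp only: mult.assoc)
  qed
  moreover have "average (\<lambda>x. \<Sum>\<nu>\<in>S. ?e \<nu> x) = (\<lambda>T. \<Sum>\<nu>\<in>S. average (?e \<nu>) T)"
    using average_sum[OF S, of ?e] locally_lebesgue_integrable_exp by blast
  moreover have "\<forall>\<nu>. \<exists>L. (average (?e \<nu>) \<longlongrightarrow> L) at_top"
    by (intro allI average_exp_convergent)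
  then obtain L where "\<forall>\<nu>. (average (?e \<nu>) \<longlongrightarrow> L \<nu>) at_top"
    by (elim choice[THEN exE])
  then have "((\<lambda>T. \<Sum>\<nu>\<in>S. average (?e \<nu>) T) \<longlongrightarrow> (\<Sum>\<nu>\<in>S. L \<nu>)) at_top"
    by (intro tendsto_sum) blast
  ultimately show ?thesis by auto
qed

text \<open>The factor \<open>2\<close> in the bound appears because the Besicovitch distance averages over \<open>[-T, T]\<close> and the
  mean value over \<open>[0, T]\<close>.\<close>

lemma average_close_of_besicovitch_dist:
  assumes f: "locally_lebesgue_integrable f" and g: "locally_lebesgue_integrable g"
    and dist: "besicovitch_dist f g < ereal e"
  shows "\<forall>\<^sub>F T in at_top. norm (average (twist \<mu> f) T - average (twist \<mu> g) T) < 2 * e"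
proof -
  have "\<forall>\<^sub>F T in at_top. ereal (1 / (2 * T) * (LINT x:{-T..T}|lebesgue. norm (f x - g x))) < ereal e"
    using dist unfolding besicovitch_dist_def by (rule Limsup_lessD)
  then show ?thesis
    using eventually_gt_at_top[of 0]
  proof eventually_elim
    case (elim T)
    let ?d = "\<lambda>x. f x - g x"
    let ?I = "LINT x:{-T..T}|lebesgue. norm (?d x)"
    have d: "locally_lebesgue_integrable ?d"
      by (rule locally_lebesgue_integrable_diff[OF f g])
    have tw: "set_integrable lebesgue {0..T} (twist \<mu> ?d)"
      by (intro locally_lebesgue_integrableD locally_lebesgue_integrable_twist d)
    have nd: "set_integrable lebesgue {-T..T} (\<lambda>x. norm (?d x))"
      by (intro set_integrable_norm locally_lebesgue_integrableD d)
    have diff: "average (twist \<mu> f) T - average (twist \<mu> g) T = average (twist \<mu> ?d) T"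
      using average_diff[OF locally_lebesgue_integrable_twist[OF f]
          locally_lebesgue_integrable_twist[OF g]]
      by (simp only: twist_diff)
    have norm_avg: "norm (average (twist \<mu> ?d) T) = 1 / T * norm (LINT x:{0..T}|lebesgue. twist \<mu> ?d x)"
      using elim(2) by (simp only: average_def norm_mult norm_of_real) simp
    have "norm (LINT x:{0..T}|lebesgue. twist \<mu> ?d x)
        \<le> (LINT x:{0..T}|lebesgue. norm (twist \<mu> ?d x))"
      by (rule set_integral_norm_bound[OF tw])
    also have "(LINT x:{0..T}|lebesgue. norm (twist \<mu> ?d x)) = (LINT x:{0..T}|lebesgue. norm (?d x))"
      by (simp only: norm_twist)
    also have "\<dots> \<le> (LINT x:{-T..T}|lebesgue. norm (?d x))"
      unfolding set_lebesgue_integral_def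
    proof (rule integral_mono)
      show "integrable lebesgue (\<lambda>x. indicat_real {0..T} x *\<^sub>R norm (?d x))"
        using set_integrable_subset[OF nd, of "{0..T}"] elim(2) unfolding set_integrable_def by simp
      show "integrable lebesgue (\<lambda>x. indicat_real {-T..T} x *\<^sub>R norm (?d x))"
        using nd unfolding set_integrable_def .
      show "indicat_real {0..T} x *\<^sub>R norm (?d x) \<le> indicat_real {-T..T} x *\<^sub>R norm (?d x)" for x
        using elim(2) by (simp add: indicator_def)
    qed
    finally have "norm (LINT x:{0..T}|lebesgue. twist \<mu> ?d x) \<le> ?I" .
    then have "norm (average (twist \<mu> ?d) T) \<le> 1 / T * ?I"
      unfolding norm_avg using elim(2) by (intro mult_left_mono) simp_all
    also have "1 / T * ?I = 2 * (1 / (2 * T) * ?I)" by simp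
    also have "\<dots> < 2 * e" using elim(1) by (simp only: ereal_less_eq less_ereal.simps)
    finally show ?case unfolding diff .
  qed
qed

text \<open>The function \<open>G\<close> is eventually close to its limit, which traps \<open>F\<close> eventually in a small ball;
  hence \<open>F\<close> is Cauchy along the filter.\<close>

lemma convergent_of_approximable:
  fixes F :: "'a \<Rightarrow> 'b::banach"
  assumes "net \<noteq> bot"
    and approx: "\<And>e. e > 0 \<Longrightarrow>
      \<exists>G L. (G \<longlongrightarrow> L) net \<and> (\<forall>\<^sub>F t in net. norm (F t - G t) < e)"
  shows "\<exists>L. (F \<longlongrightarrow> L) net"
proof -
  have "cauchy_filter (filtermap F net)"
    unfolding cauchy_filter_metric_filtermap
  proof (intro allI impI)
    fix e :: real assume "e > 0"
    \<comment> \<open>One quarter for \<open>F\<close> to \<open>G\<close> and one for \<open>G\<close> to \<open>L\<close> leave both \<open>F x\<close> and \<open>F y\<close> within \<open>e / 2\<close> of \<open>L\<close>.\<close>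
    then obtain G L where G: "(G \<longlongrightarrow> L) net" and FG: "\<forall>\<^sub>F t in net. norm (F t - G t) < e / 4"
      using approx[of "e / 4"] by auto
    have "\<forall>\<^sub>F t in net. dist (G t) L < e / 4" using tendstoD[OF G, of "e / 4"] \<open>e > 0\<close> by simp
    then have "\<forall>\<^sub>F t in net. dist (F t) L < e / 2"
      using FG
    proof eventually_elim
      case (elim t)
      then show ?case using dist_triangle[of "F t" L "G t"] by (simp add: dist_norm)
    qed
    then show "\<exists>P. eventually P net \<and> (\<forall>x y. P x \<and> P y \<longrightarrow> dist (F x) (F y) < e)"
      by (intro exI[of _ "\<lambda>t. dist (F t) L < e / 2"]) (use dist_triangle_half_l in blast)
  qed
  moreover have "complete (UNIV :: 'b set)"
    by (meson Cauchy_convergent UNIV_I complete_def convergent_def)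
  ultimately show ?thesis
    using assms(1) complete_uniform[where S = "UNIV :: 'b set"]
    by (force simp: filterlim_def filtermap_bot_iff)
qed

lemma B_ap_average_convergent:
  assumes "B_ap f"
  shows "\<exists>L. (average (twist \<mu> f) \<longlongrightarrow> L) at_top"
proof (rule convergent_of_approximable)
  fix e :: real assume e: "e > 0"
  obtain p where f: "locally_lebesgue_integrable f" and p: "\<And>N. trig_sum (p N)"
    and lim: "(\<lambda>N::nat. besicovitch_dist f (p N)) \<longlonglongrightarrow> 0"
    using assms unfolding B_ap_def by auto
  obtain N where "besicovitch_dist f (p N) < ereal (e / 2)"
    using order_tendstoD(2)[OF lim, of "ereal (e / 2)"] e
    by (auto simp: eventually_sequentially)
  from average_close_of_besicovitch_dist[OF f trig_sum_locally_lebesgue_integrable[OF p] this, of \<mu>]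
  have close: "\<forall>\<^sub>F T in at_top. norm (average (twist \<mu> f) T - average (twist \<mu> (p N)) T) < e"
    by (simp only: mult_2 field_sum_of_halves)
  obtain L where "(average (twist \<mu> (p N)) \<longlongrightarrow> L) at_top"
    using trig_sum_average_convergent[OF p] by blast
  with close
  show "\<exists>G L. (G \<longlongrightarrow> L) at_top \<and> (\<forall>\<^sub>F T in at_top. norm (average (twist \<mu> f) T - G T) < e)"
    by (intro exI conjI)
qed simp

lemma bohr_coeff_eqI:
  assumes "(average (twist \<mu> f) \<longlongrightarrow> L) at_top"
  shows "bohr_coeff f \<mu> = L"
proof -
  have "bohr_coeff f \<mu> = Lim at_top (average (twist \<mu> f))"
    by (simp only: bohr_coeff_def mean_value_def average_def[abs_def] twist_def)
  also have "\<dots> = L" by (rule tendsto_Lim[OF trivial_limit_at_top_linorder assms])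
  finally show ?thesis .
qed

lemma average_tendsto_bohr_coeff:
  assumes "B_ap f"
  shows "(average (twist \<mu> f) \<longlongrightarrow> bohr_coeff f \<mu>) at_top"
proof -
  obtain L where L: "(average (twist \<mu> f) \<longlongrightarrow> L) at_top"
    by (rule exE[OF B_ap_average_convergent[OF assms]])
  then show ?thesis unfolding bohr_coeff_eqI[OF L] .
qed

lemma bohr_coeff_diff:
  assumes f: "B_ap f" and g: "B_ap g"
  shows "bohr_coeff (\<lambda>x. f x - g x) \<mu> = bohr_coeff f \<mu> - bohr_coeff g \<mu>"
proof (rule bohr_coeff_eqI)
  have loc: "locally_lebesgue_integrable (twist \<mu> f)" "locally_lebesgue_integrable (twist \<mu> g)"
    using f g locally_lebesgue_integrable_twist unfolding B_ap_def by auto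
  have "average (twist \<mu> (\<lambda>x. f x - g x)) = (\<lambda>T. average (twist \<mu> f) T - average (twist \<mu> g) T)"
    using average_diff[OF loc] by (simp add: twist_diff fun_eq_iff)
  then show "(average (twist \<mu> (\<lambda>x. f x - g x)) \<longlongrightarrow> bohr_coeff f \<mu> - bohr_coeff g \<mu>) at_top"
    using tendsto_diff[OF average_tendsto_bohr_coeff[OF f] average_tendsto_bohr_coeff[OF g]]
    by (simp only:)
qed

section \<open>Monotonicity of the exponents\<close>

lemma exponent_seq_mono:
  assumes "exponent_seq lam" "i \<le> j"
  shows "lam (int i) \<le> lam (int j)"
proof (rule lift_Suc_mono_le[OF _ \<open>i \<le> j\<close>])
  fix m
  show "lam (int m) \<le> lam (int (Suc m))"
  proof (cases m)
    case 0
    have "0 < lam 1" "lam 0 = 0" using assms(1) unfolding exponent_seq_def by auto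
    then show ?thesis using 0 by simp
  next
    case (Suc l)
    then have "lam (int m) < lam (int m + 1)"
      using assms(1) unfolding exponent_seq_def by (simp del: of_nat_Suc)
    then show ?thesis by (simp add: add.commute)
  qed
qed

lemma exponent_seq_abs:
  assumes "exponent_seq lam"
  shows "\<bar>lam k\<bar> = lam (int (nat \<bar>k\<bar>))"
proof -
  have "lam 0 = 0" "lam (- k) = - lam k" using assms unfolding exponent_seq_def by auto
  moreover have "0 \<le> lam (int (nat \<bar>k\<bar>))"
    using exponent_seq_mono[OF assms, of 0 "nat \<bar>k\<bar>"] \<open>lam 0 = 0\<close> by simp
  ultimately show ?thesis by (cases "k \<ge> 0") auto
qed

section \<open>Coefficient tails and the modulus of smoothness\<close>

text \<open>Subtracting a competitor does not change the coefficients in the tail, and the norm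
  dominates every finite weighted sum of coefficients.\<close>

lemma tail_sum_le_best_approx:
  assumes lam: "exponent_seq lam" and f: "B_ap f" and \<gamma>: "\<gamma> \<in> Gamma_set M" and "finite K"
    and K: "\<And>k. k \<in> K \<Longrightarrow> \<nu> \<le> nat \<bar>k\<bar>"
  shows "(\<Sum>k\<in>K. ennreal (\<gamma> k * norm (bohr_coeff f (lam k)))) \<le> best_approx lam M (lam (int \<nu>)) f"
  unfolding best_approx_def
proof (rule INF_greatest)
  fix g assume "g \<in> {g \<in> B_ap_exps lam. fourier_exponents g \<subseteq> {- lam (int \<nu>)<..<lam (int \<nu>)}}"
  then have g: "B_ap g" and exps: "fourier_exponents g \<subseteq> {- lam (int \<nu>)<..<lam (int \<nu>)}"
    unfolding B_ap_exps_def by auto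
  let ?c = "\<lambda>k. ennreal (\<gamma> k * norm (bohr_coeff (\<lambda>x. f x - g x) (lam k)))"
  have "bohr_coeff (\<lambda>x. f x - g x) (lam k) = bohr_coeff f (lam k)" if "k \<in> K" for k
  proof -
    have "lam (int \<nu>) \<le> \<bar>lam k\<bar>"
      using exponent_seq_mono[OF lam K[OF that]] exponent_seq_abs[OF lam] by simp
    then have "bohr_coeff g (lam k) = 0"
      using exps unfolding fourier_exponents_def by (auto simp: subset_iff)
    then show ?thesis using bohr_coeff_diff[OF f g] by simp
  qed
  then have "(\<Sum>k\<in>K. ennreal (\<gamma> k * norm (bohr_coeff f (lam k)))) = sum ?c K"
    by (intro sum.cong) auto
  also have "\<dots> \<le> infsum ?c UNIV"
    unfolding nonneg_infsum_complete[of UNIV ?c, OF zero_le]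
    using \<open>finite K\<close> by (intro SUP_upper) auto
  also have "\<dots> \<le> M_norm lam M (\<lambda>x. f x - g x)"
    unfolding M_norm_def using \<gamma> by (rule SUP_upper)
  finally show "(\<Sum>k\<in>K. ennreal (\<gamma> k * norm (bohr_coeff f (lam k)))) \<le> M_norm lam M (\<lambda>x. f x - g x)" .
qed

text \<open>Evenness moves \<open>\<lambda>\<^sub>k h\<close> to the positive axis. For \<open>\<bar>k\<bar> \<le> n\<close> it then lies in \<open>[0, \<tau>]\<close>, where \<open>\<phi>\<close> is
  monotone; for \<open>\<bar>k\<bar> > n\<close> the argument on the right is \<open>\<tau>\<close> itself. The bound is free of \<open>h\<close> and
  telescopes in \<open>min \<bar>k\<bar> n\<close>.\<close>

lemma multiplier_le_truncated:
  assumes lam: "exponent_seq lam" and \<phi>: "\<phi> \<in> Phi_class" and mono: "mono_on {0..\<tau>} \<phi>"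
    and max: "\<And>t. \<phi> t \<le> \<phi> \<tau>" and "n \<ge> 1" and h: "\<bar>h\<bar> \<le> \<tau> / lam (int n)"
  shows "\<phi> (lam k * h) \<le> \<phi> (\<tau> * lam (int (min (nat \<bar>k\<bar>) n)) / lam (int n))"
proof -
  have pos: "lam (int n) > 0" using lam \<open>n \<ge> 1\<close> unfolding exponent_seq_def by simp
  let ?m = "nat \<bar>k\<bar>"
  show ?thesis
  proof (cases "?m \<le> n")
    case True
    have le: "lam (int ?m) \<le> lam (int n)" using exponent_seq_mono[OF lam True] .
    have nonneg: "0 \<le> lam (int ?m)" by (metis abs_ge_zero exponent_seq_abs[OF lam])
    have "\<tau> \<ge> 0"
    proof -
      have "0 \<le> \<tau> / lam (int n)" using h by linarith
      then show ?thesis using pos by (simp add: zero_le_divide_iff)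
    qed
    have even: "\<phi> (lam k * h) = \<phi> \<bar>lam k * h\<bar>"
      using \<phi> unfolding Phi_class_def abs_if by auto
    have abs: "\<bar>lam k * h\<bar> \<le> \<tau> * lam (int ?m) / lam (int n)"
      using mult_left_mono[OF h nonneg] exponent_seq_abs[OF lam, of k]
      by (simp add: abs_mult mult.commute)
    have top: "\<tau> * lam (int ?m) / lam (int n) \<le> \<tau>"
      using mult_left_mono[OF le \<open>\<tau> \<ge> 0\<close>] pos by (simp add: divide_le_eq)
    have "\<phi> \<bar>lam k * h\<bar> \<le> \<phi> (\<tau> * lam (int ?m) / lam (int n))"
      by (rule mono_onD[OF mono _ _ abs]) (use abs top in auto)
    then show ?thesis using True even by (simp add: min_def)
  next
    case False
    then show ?thesis using max[of "lam k * h"] pos by (simp add: min_def)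
  qed
qed

theorem theorem4p1:
  fixes lam :: "int \<Rightarrow> real" and M :: "int \<Rightarrow> real \<Rightarrow> real"
    and f :: "real \<Rightarrow> complex" and \<phi> :: "real \<Rightarrow> real" and \<tau> :: real and n :: nat
  assumes "exponent_seq lam"
    and "\<And>k. orlicz_function (M k)"
    and "f \<in> BS_space lam M"
    and "fourier_series_F lam f"
    and "\<tau> > 0"
    and "\<phi> \<in> Phi_class"
    and "mono_on {0..\<tau>} \<phi>"
    and "\<And>t. \<phi> t \<le> \<phi> \<tau>"
    and "n \<ge> 1"
  shows "gen_modulus lam M \<phi> f (\<tau> / lam (int n))
    \<le> (\<Sum>\<nu> = 1..n. ennreal (\<phi> (\<tau> * lam (int \<nu>) / lam (int n)) - \<phi> (\<tau> * lam (int \<nu> - 1) / lam (int n)))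
          * best_approx lam M (lam (int \<nu>)) f)"
proof -
  let ?\<Delta> = "\<lambda>\<nu>. \<phi> (\<tau> * lam (int \<nu>) / lam (int n)) - \<phi> (\<tau> * lam (int \<nu> - 1) / lam (int n))"
  let ?R = "\<Sum>\<nu> = 1..n. ennreal (?\<Delta> \<nu>) * best_approx lam M (lam (int \<nu>)) f"
  have lam0: "lam 0 = 0" and pos: "lam (int n) > 0"
    using assms(1,9) unfolding exponent_seq_def by auto
  have f: "B_ap f" using assms(3) unfolding BS_space_def B_ap_exps_def by simp
  have \<phi>0: "\<phi> 0 = 0" using assms(6) unfolding Phi_class_def by simp
  have telescope: "(\<Sum>\<nu> = 1..m. ?\<Delta> \<nu>) = \<phi> (\<tau> * lam (int m) / lam (int n))" for m
    by (induction m) (simp_all add: lam0 \<phi>0)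
  have \<Delta>_nonneg: "0 \<le> ?\<Delta> \<nu>" if "\<nu> \<in> {1..n}" for \<nu>
  proof -
    have eq: "int \<nu> - 1 = int (\<nu> - 1)" using that by auto
    have ord: "0 \<le> lam (int (\<nu> - 1))" "lam (int (\<nu> - 1)) \<le> lam (int \<nu>)" "lam (int \<nu>) \<le> lam (int n)"
      using exponent_seq_mono[OF assms(1), of 0 "\<nu> - 1"] exponent_seq_mono[OF assms(1), of "\<nu> - 1" \<nu>]
        exponent_seq_mono[OF assms(1), of \<nu> n] that lam0 by auto
    have mult: "\<tau> * lam (int (\<nu> - 1)) \<le> \<tau> * lam (int \<nu>)" "\<tau> * lam (int \<nu>) \<le> \<tau> * lam (int n)"
      using ord assms(5) by auto
    have "\<phi> (\<tau> * lam (int (\<nu> - 1)) / lam (int n)) \<le> \<phi> (\<tau> * lam (int \<nu>) / lam (int n))"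
    proof (rule mono_onD[OF assms(7)])
      show "\<tau> * lam (int (\<nu> - 1)) / lam (int n) \<in> {0..\<tau>}" "\<tau> * lam (int \<nu>) / lam (int n) \<in> {0..\<tau>}"
        using ord mult pos assms(5) by (auto simp: divide_le_eq)
      show "\<tau> * lam (int (\<nu> - 1)) / lam (int n) \<le> \<tau> * lam (int \<nu>) / lam (int n)"
        using mult(1) pos by (simp add: divide_right_mono)
    qed
    then show ?thesis unfolding eq by simp
  qed
  have "(\<Sum>\<^sub>\<infinity>k\<in>UNIV. ennreal (\<gamma> k * \<phi> (lam k * h) * norm (bohr_coeff f (lam k)))) \<le> ?R"
    if h: "\<bar>h\<bar> \<le> \<tau> / lam (int n)" and \<gamma>: "\<gamma> \<in> Gamma_set M" for h \<gamma>
    \<comment> \<open>Passing to finite partial sums makes the interchange of summations an identity of finite sums.\<close>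
  proof (rule infsum_le_finite_sums)
    fix K :: "int set" assume K: "finite K"
    let ?a = "\<lambda>k. \<gamma> k * norm (bohr_coeff f (lam k))"
    have a_nonneg: "0 \<le> ?a k" for k using \<gamma> unfolding Gamma_set_def by (simp add: less_imp_le)
    have term_le: "ennreal (\<gamma> k * \<phi> (lam k * h) * norm (bohr_coeff f (lam k)))
        \<le> (\<Sum>\<nu> = 1..n. if \<nu> \<le> nat \<bar>k\<bar> then ennreal (?\<Delta> \<nu>) * ennreal (?a k) else 0)" for k
    proof -
      have range: "{1..min (nat \<bar>k\<bar>) n} = {\<nu> \<in> {1..n}. \<nu> \<le> nat \<bar>k\<bar>}" by auto
      have "\<phi> (lam k * h) \<le> (\<Sum>\<nu> = 1..min (nat \<bar>k\<bar>) n. ?\<Delta> \<nu>)"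
        unfolding telescope by (rule multiplier_le_truncated[OF assms(1,6,7,8,9) h])
      from mult_right_mono[OF this a_nonneg[of k]]
      have "ennreal (\<gamma> k * \<phi> (lam k * h) * norm (bohr_coeff f (lam k)))
          \<le> ennreal (\<Sum>\<nu> = 1..min (nat \<bar>k\<bar>) n. ?\<Delta> \<nu> * ?a k)"
        unfolding sum_distrib_right by (intro ennreal_leI) (simp only: mult_ac)
      also have "\<dots> = (\<Sum>\<nu> = 1..min (nat \<bar>k\<bar>) n. ennreal (?\<Delta> \<nu> * ?a k))"
        by (intro sum_ennreal[symmetric] mult_nonneg_nonneg \<Delta>_nonneg a_nonneg) simp
      also have "\<dots> = (\<Sum>\<nu> = 1..min (nat \<bar>k\<bar>) n. ennreal (?\<Delta> \<nu>) * ennreal (?a k))"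
        by (intro sum.cong refl ennreal_mult \<Delta>_nonneg a_nonneg) simp
      finally show ?thesis unfolding range by (simp only: sum.inter_filter finite_atLeastAtMost)
    qed
    have "(\<Sum>k\<in>K. ennreal (\<gamma> k * \<phi> (lam k * h) * norm (bohr_coeff f (lam k))))
        \<le> (\<Sum>k\<in>K. \<Sum>\<nu> = 1..n. if \<nu> \<le> nat \<bar>k\<bar> then ennreal (?\<Delta> \<nu>) * ennreal (?a k) else 0)"
      by (intro sum_mono term_le)
    also have "\<dots> = (\<Sum>\<nu> = 1..n. \<Sum>k\<in>K. if \<nu> \<le> nat \<bar>k\<bar> then ennreal (?\<Delta> \<nu>) * ennreal (?a k) else 0)"
      by (rule sum.swap)
    also have "\<dots> = (\<Sum>\<nu> = 1..n. ennreal (?\<Delta> \<nu>) * (\<Sum>k\<in>{k \<in> K. \<nu> \<le> nat \<bar>k\<bar>}. ennreal (?a k)))"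
      unfolding sum_distrib_left sum.inter_filter[OF K] by (intro sum.cong refl) simp
    also have "\<dots> \<le> ?R"
      using K by (intro sum_mono mult_left_mono tail_sum_le_best_approx[OF assms(1) f \<gamma>]) auto
    finally show "(\<Sum>k\<in>K. ennreal (\<gamma> k * \<phi> (lam k * h) * norm (bohr_coeff f (lam k)))) \<le> ?R" .
  qed (simp add: nonneg_summable_on_complete)
  then show ?thesis
    unfolding gen_modulus_def by (intro SUP_least) auto
qed

end
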